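(* Let $1\le k\le n-1$. The set $$\left\{\eta_J:\ J\in\binom{[n]}{k}\text{ is nonfrozen}\right\}$$ is a basis of the space of linear functions on the kinematic space $\mathcal{K}_{k,n}$ (i.e. of the dual vector space of $\mathcal{K}_{k,n}$).
   Context: $[n]=\{1,\ldots,n\}$, indices modulo $n$. For $J\in\binom{[n]}{k}$, $e_J=\sum_{j\in J}e_j$ is a vertex of $\Delta_{k,n}=\{x\in[0,1]^n:\sum x_i=k\}$. $J$ (or $e_J$) is frozen if $J=\{i,i+1,\ldots,i+k-1\}$ (mod $n$) for some $i$, and nonfrozen otherwise. The kinematic space is $$\mathcal{K}_{k,n}=\left\{(s_J)\in\mathbb{R}^{\binom{n}{k}}:\ \sum_{J\in\binom{[n]}{k}:\,J\ni a}s_J=0\ \text{ for each }a=1,\ldots,n\right\}.$$ On $\{x\in\mathbb{R}^n:\sum x_i=0\}$ define $h(x)=\min\{L_1(x),\ldots,L_n(x)\}$, where $L_j(x)=x_{j+1}+2x_{j+2}+\cdots+(n-1)x_{j-1}$ (indices modulo $n$; $x_j$ has coefficient $0$). For $J\in\binom{[n]}{k}$ put $\rho_J(x)=h(x-e_J)$ for $x\in\Delta_{k,n}$, and define the planar element $$\eta_J(s)=-\frac1n\sum_{I\in\binom{[n]}{k}}s_I\,\rho_J(e_I).$$ *)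

theory Defs
  imports Complex_Main "HOL-Library.Function_Algebras"
begin

text \<open>Pointwise scalar multiplication. Together with the pointwise addition of
  Function_Algebras it makes the library's \<^const>\<open>span\<close> and \<^const>\<open>independent\<close>
  available for spaces of functions.\<close>

instantiation "fun" :: (type, real_vector) real_vector
begin

definition scaleR_fun :: "real \<Rightarrow> ('a \<Rightarrow> 'b) \<Rightarrow> 'a \<Rightarrow> 'b" where
  "scaleR_fun c f = (\<lambda>x. c *\<^sub>R f x)"

instance
  by standard (auto simp: scaleR_fun_def plus_fun_def scaleR_add_right scaleR_add_left)

end

text \<open>The dual of a subspace \<open>V\<close>. A linear function on \<open>V\<close> is represented by its
  extension by 0 outside \<open>V\<close>, so that each one has exactly one representative and the
  vector space operations are the pointwise ones.\<close>

definition dual_space :: "'a::real_vector set \<Rightarrow> ('a \<Rightarrow> real) set" where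
  "dual_space V = {f. (\<forall>x\<in>V. \<forall>y\<in>V. f (x + y) = f x + f y) \<and>
                      (\<forall>c. \<forall>x\<in>V. f (c *\<^sub>R x) = c * f x) \<and>
                      (\<forall>x. x \<notin> V \<longrightarrow> f x = 0)}"

definition ksubsets :: "nat \<Rightarrow> nat \<Rightarrow> nat set set" where
  "ksubsets n k = {J. J \<subseteq> {1..n} \<and> card J = k}"

text \<open>The representative in \<open>{1..n}\<close> of an index modulo \<open>n\<close>.\<close>

definition cyc :: "nat \<Rightarrow> nat \<Rightarrow> nat" where
  "cyc n m = (if n dvd m then n else m mod n)"

definition frozen :: "nat \<Rightarrow> nat \<Rightarrow> nat set \<Rightarrow> bool" where
  "frozen n k J \<longleftrightarrow> (\<exists>i\<in>{1..n}. J = cyc n ` {i..<i + k})"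

text \<open>A vector \<open>(s\<^sub>J)\<close> indexed by the \<open>k\<close>-subsets is a function on all sets of
  naturals that vanishes off the index set.\<close>

definition kinematic_space :: "nat \<Rightarrow> nat \<Rightarrow> (nat set \<Rightarrow> real) set" where
  "kinematic_space n k = {s. (\<forall>J. J \<notin> ksubsets n k \<longrightarrow> s J = 0) \<and>
                             (\<forall>a\<in>{1..n}. (\<Sum>J\<in>{J \<in> ksubsets n k. a \<in> J}. s J) = 0)}"

text \<open>Points of \<open>\<real>\<^sup>n\<close> are functions of which only the values on \<open>{1..n}\<close> are used.\<close>

definition vertex :: "nat set \<Rightarrow> nat \<Rightarrow> real" where
  "vertex J = (\<lambda>j. if j \<in> J then 1 else 0)"

definition L_form :: "nat \<Rightarrow> nat \<Rightarrow> (nat \<Rightarrow> real) \<Rightarrow> real" where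
  "L_form n j x = (\<Sum>i=1..n - 1. real i * x (cyc n (j + i)))"

definition h_fun :: "nat \<Rightarrow> (nat \<Rightarrow> real) \<Rightarrow> real" where
  "h_fun n x = Min ((\<lambda>j. L_form n j x) ` {1..n})"

definition rho :: "nat \<Rightarrow> nat set \<Rightarrow> (nat \<Rightarrow> real) \<Rightarrow> real" where
  "rho n J x = h_fun n (x - vertex J)"

text \<open>The case distinction is the extension by 0 used in \<^const>\<open>dual_space\<close>.\<close>

definition eta :: "nat \<Rightarrow> nat \<Rightarrow> nat set \<Rightarrow> (nat set \<Rightarrow> real) \<Rightarrow> real" where
  "eta n k J = (\<lambda>s. if s \<in> kinematic_space n k
                    then - (1 / real n) * (\<Sum>I\<in>ksubsets n k. s I * rho n J (vertex I))
                    else 0)"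

lemma subspace_kinematic_space: "subspace (kinematic_space n k)"
  unfolding subspace_def kinematic_space_def
  by (auto simp: scaleR_fun_def sum.distrib simp flip: sum_distrib_left)

lemma subspace_dual_space:
  assumes "subspace V"
  shows "subspace (dual_space V)"
  using assms unfolding subspace_def dual_space_def
  by (auto simp: scaleR_fun_def algebra_simps)

lemma eta_in_dual_space: "eta n k J \<in> dual_space (kinematic_space n k)"
proof -
  note sub = subspace_kinematic_space[of n k]
  show ?thesis
    unfolding dual_space_def eta_def
    using subspace_add[OF sub] subspace_scale[OF sub]
    by (auto simp: scaleR_fun_def algebra_simps sum.distrib add_divide_distrib sum_distrib_left)
qed

end

theory Submission
  imports Defs
begin

text \<open>Let \<open>h\<^sub>j(J)\<close> be the sum of the distances from \<open>j\<close> forward around the circle to the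
  elements of \<open>J\<close>. Since the coefficient of \<open>x\<^sub>b\<close> in \<open>L\<^sub>j\<close> is the distance from \<open>j\<close> to \<open>b\<close>,
  the number \<open>\<rho>\<^sub>J(e\<^sub>I)\<close> is the minimum over \<open>j\<close> of \<open>r(j) = h\<^sub>j(I) - h\<^sub>j(J)\<close>. The proof rests on
  one property of \<open>r\<close>: from \<open>j\<close> to its successor it changes by \<open>n([j \<in> I] - [j \<in> J])\<close>. So \<open>r\<close>
  does not increase along \<open>J\<close>, does not decrease off \<open>J\<close>, and is constant modulo \<open>n\<close>.

  If \<open>J\<close> is a single cyclic interval, then \<open>r\<close> is minimal at the first place after it, for
  every \<open>I\<close>. Hence \<open>\<rho>\<^sub>J\<close> is an affine function on the vertices. Affine functions are killed
  by the equations of the kinematic space, so frozen planar elements vanish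
  (\<open>eta_frozen_eq_0\<close>).

  For arbitrary \<open>J\<close>, let \<open>B\<close> be the set of initial points of its cyclic intervals, and for
  \<open>M \<subseteq> B\<close> let \<open>J\<^sub>M\<close> be \<open>J\<close> with the points of \<open>M\<close> moved one step back. This changes \<open>r\<close> by
  the constant \<open>|M|\<close> and by \<open>-n\<close> at the points of \<open>M\<close>. Because \<open>r\<close> is constant modulo \<open>n\<close>, the
  minimum drops by \<open>n\<close> exactly if \<open>M\<close> contains a minimizer of \<open>r\<close>. In the alternating sum
  over all \<open>M \<subseteq> B\<close> everything that depends on \<open>I\<close> then cancels, unless all of \<open>B\<close> consists of
  minimizers; and by the monotonicity of \<open>r\<close> this forces \<open>r\<close> to be constant, i.e. \<open>I = J\<close>.
  Therefore the alternating sum of the planar elements of the sets \<open>J\<^sub>M\<close> is \<open>-s\<^sub>J\<close> (\<open>alternating_sum_eta\<close>). The coordinates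
  \<open>s\<^sub>J\<close> span the dual space, hence so do the nonfrozen planar elements.

  Independence is a count. There are at least \<open>n\<close> frozen sets (\<open>card_frozen_ge\<close>). If one
  nonfrozen planar element were redundant, the others together with the \<open>n\<close> equations of the
  kinematic space would be fewer linear conditions than there are \<open>k\<close>-subsets, so a nonzero
  point of the kinematic space would be annihilated by its whole dual
  (\<open>few_eta_not_spanning\<close>).\<close>

section \<open>Cyclic distances\<close>

definition cdist :: "nat \<Rightarrow> nat \<Rightarrow> nat \<Rightarrow> int" where
  "cdist n j b = (int b - int j) mod int n"

definition nxt :: "nat \<Rightarrow> nat \<Rightarrow> nat" where
  "nxt n j = cyc n (j + 1)"

text \<open>Going \<open>n - 1\<close> steps forward goes one step back without truncated subtraction.\<close>

definition prv :: "nat \<Rightarrow> nat \<Rightarrow> nat" where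
  "prv n j = cyc n (j + (n - 1))"

lemma cyc_in_range: "n \<ge> 1 \<Longrightarrow> cyc n m \<in> {1..n}"
  by (auto simp: cyc_def dvd_eq_mod_eq_0 Suc_le_eq less_imp_le)

lemma int_cyc_mod: "int (cyc n m) mod int n = int m mod int n"
  by (auto simp: cyc_def zmod_int)

lemma nxt_in_range: "n \<ge> 1 \<Longrightarrow> nxt n j \<in> {1..n}"
  unfolding nxt_def by (rule cyc_in_range)

lemma prv_in_range: "n \<ge> 1 \<Longrightarrow> prv n j \<in> {1..n}"
  unfolding prv_def by (rule cyc_in_range)

lemma eq_if_int_mod_eq:
  assumes "a \<in> {1..n}" "b \<in> {1..n}" "int a mod int n = int b mod int n"
  shows "a = b"
proof -
  have "int n dvd int a - int b" using assms(3) by (simp add: mod_eq_dvd_iff)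
  moreover have "\<bar>int a - int b\<bar> < int n" using assms(1,2) by auto
  ultimately have "int a - int b = 0" using dvd_imp_le_int[of "int a - int b" "int n"] by linarith
  thus ?thesis by simp
qed

lemma int_nxt_mod: "int (nxt n j) mod int n = (int j + 1) mod int n"
  by (simp add: nxt_def int_cyc_mod add.commute)

lemma int_prv_mod:
  assumes "n \<ge> 1" shows "int (prv n j) mod int n = (int j - 1) mod int n"
proof -
  have "int (prv n j) mod int n = ((int j - 1) + int n) mod int n"
    using assms by (simp add: prv_def int_cyc_mod of_nat_diff algebra_simps)
  thus ?thesis by simp
qed

lemma nxt_prv:
  assumes "a \<in> {1..n}" shows "nxt n (prv n a) = a"
proof (rule eq_if_int_mod_eq[of _ n])
  have n: "n \<ge> 1" using assms by auto
  show "nxt n (prv n a) \<in> {1..n}" by (rule nxt_in_range[OF n])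
  show "int (nxt n (prv n a)) mod int n = int a mod int n"
    using mod_add_left_eq[of "int (prv n a)" "int n" 1] mod_add_left_eq[of "int a - 1" "int n" 1]
    by (simp add: int_nxt_mod int_prv_mod[OF n])
qed (rule assms)

lemma inj_on_prv: "inj_on (prv n) {1..n}"
  by (metis inj_on_inverseI nxt_prv)

lemma cdist_bounds: "n \<ge> 1 \<Longrightarrow> 0 \<le> cdist n j b \<and> cdist n j b < int n"
  by (simp add: cdist_def)

lemma cdist_eq_0_iff:
  assumes "j \<in> {1..n}" "b \<in> {1..n}" shows "cdist n j b = 0 \<longleftrightarrow> j = b"
  using eq_if_int_mod_eq[OF assms(2,1)] by (auto simp: cdist_def mod_eq_dvd_iff dvd_eq_mod_eq_0)

lemma cdist_cyc:
  assumes "t < n" shows "cdist n j (cyc n (j + t)) = int t"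
proof -
  have "cdist n j (cyc n (j + t)) = (int (cyc n (j + t)) mod int n - int j) mod int n"
    by (simp add: cdist_def mod_diff_left_eq)
  also have "\<dots> = (int (j + t) - int j) mod int n"
    by (simp add: int_cyc_mod mod_diff_left_eq)
  finally show ?thesis using assms by simp
qed

lemma cyc_cdist:
  assumes "b \<in> {1..n}" shows "cyc n (j + nat (cdist n j b)) = b"
proof (rule eq_if_int_mod_eq[of _ n])
  have n: "n \<ge> 1" using assms by auto
  show "cyc n (j + nat (cdist n j b)) \<in> {1..n}" by (rule cyc_in_range[OF n])
  have "int (cyc n (j + nat (cdist n j b))) mod int n = (int j + cdist n j b) mod int n"
    using cdist_bounds[OF n, of j b] by (simp add: int_cyc_mod)
  thus "int (cyc n (j + nat (cdist n j b))) mod int n = int b mod int n"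
    by (simp add: cdist_def mod_add_right_eq)
qed (rule assms)

lemma mod_minus_one:
  assumes "n > (0::int)" shows "(x - 1) mod n = x mod n - 1 + (if x mod n = 0 then n else 0)"
proof -
  have *: "(x - 1) mod n = (x mod n - 1) mod n" by (simp add: mod_diff_left_eq)
  show ?thesis
  proof (cases "x mod n = 0")
    case True
    thus ?thesis using * assms by (simp add: zmod_minus1)
  next
    case False
    hence "x mod n \<ge> 1" "x mod n < n"
      using pos_mod_sign[OF assms, of x] pos_mod_bound[OF assms, of x] by linarith+
    hence "(x mod n - 1) mod n = x mod n - 1" by (intro mod_pos_pos_trivial) auto
    thus ?thesis using * False by simp
  qed
qed

lemma cdist_nxt:
  assumes "j \<in> {1..n}" "b \<in> {1..n}"
  shows "cdist n (nxt n j) b = cdist n j b - 1 + (if j = b then int n else 0)"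
proof -
  have "cdist n (nxt n j) b = (int b - int (nxt n j) mod int n) mod int n"
    by (simp add: cdist_def mod_diff_right_eq)
  also have "\<dots> = ((int b - int j) - 1) mod int n"
    by (simp add: int_nxt_mod mod_diff_right_eq algebra_simps)
  also have "\<dots> = cdist n j b - 1 + (if cdist n j b = 0 then int n else 0)"
    unfolding cdist_def using assms by (intro mod_minus_one) auto
  finally show ?thesis using cdist_eq_0_iff[OF assms] by simp
qed

lemma cdist_prv:
  assumes "j \<in> {1..n}" "b \<in> {1..n}"
  shows "cdist n j (prv n b) = cdist n j b - 1 + (if j = b then int n else 0)"
proof -
  have n: "n \<ge> 1" using assms by auto
  have "cdist n j (prv n b) = (int (prv n b) mod int n - int j) mod int n"
    by (simp add: cdist_def mod_diff_left_eq)
  also have "\<dots> = ((int b - int j) - 1) mod int n"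
    by (simp add: int_prv_mod[OF n] mod_diff_left_eq algebra_simps)
  also have "\<dots> = cdist n j b - 1 + (if cdist n j b = 0 then int n else 0)"
    unfolding cdist_def using assms by (intro mod_minus_one) auto
  finally show ?thesis using cdist_eq_0_iff[OF assms] by simp
qed

text \<open>For any \<open>b\<close>, the element \<open>x\<close> of \<open>S\<close> that comes first when going forward from \<open>b\<close> is \<open>b\<close>
  itself: otherwise the predecessor of \<open>x\<close> would come earlier.\<close>

lemma prv_closed_eq_all:
  assumes "S \<subseteq> {1..n}" "S \<noteq> {}" "\<And>a. a \<in> S \<Longrightarrow> prv n a \<in> S"
  shows "S = {1..n}"
proof -
  have "b \<in> S" if b: "b \<in> {1..n}" for b
  proof -
    define x where "x = arg_min_on (cdist n b) S"
    have fin: "finite S" using assms(1) finite_subset by blast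
    have x: "x \<in> S" "\<And>y. y \<in> S \<Longrightarrow> cdist n b x \<le> cdist n b y"
      using arg_min_if_finite(1)[OF fin assms(2)] arg_min_least[OF fin assms(2)]
      by (auto simp: x_def)
    have "cdist n b x \<le> cdist n b (prv n x)" using x assms(3) by blast
    also have "\<dots> = cdist n b x - 1 + (if b = x then int n else 0)"
      using x(1) assms(1) b by (intro cdist_prv) auto
    finally show ?thesis using x(1) by (auto split: if_splits)
  qed
  thus ?thesis using assms(1) by auto
qed

text \<open>The mirror image: the last element of \<open>S\<close> before \<open>b\<close> has to be \<open>b\<close>.\<close>

lemma nxt_closed_eq_all:
  assumes "S \<subseteq> {1..n}" "S \<noteq> {}" "\<And>a. a \<in> S \<Longrightarrow> nxt n a \<in> S"
  shows "S = {1..n}"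
proof -
  have "b \<in> S" if b: "b \<in> {1..n}" for b
  proof -
    define x where "x = arg_min_on (\<lambda>x. cdist n x b) S"
    have fin: "finite S" using assms(1) finite_subset by blast
    have x: "x \<in> S" "\<And>y. y \<in> S \<Longrightarrow> cdist n x b \<le> cdist n y b"
      using arg_min_if_finite(1)[OF fin assms(2), of "\<lambda>x. cdist n x b"]
        arg_min_least[OF fin assms(2), of _ "\<lambda>x. cdist n x b"]
      by (auto simp: x_def)
    have "cdist n x b \<le> cdist n (nxt n x) b" using x assms(3) by blast
    also have "\<dots> = cdist n x b - 1 + (if x = b then int n else 0)"
      using x(1) assms(1) b by (intro cdist_nxt) auto
    finally show ?thesis using x(1) by (auto split: if_splits)
  qed
  thus ?thesis using assms(1) by auto
qed

section \<open>The planar elements in terms of distances\<close>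

definition height :: "nat \<Rightarrow> nat \<Rightarrow> nat set \<Rightarrow> int" where
  "height n j J = (\<Sum>b\<in>J. cdist n j b)"

definition rel_height :: "nat \<Rightarrow> nat set \<Rightarrow> nat set \<Rightarrow> nat \<Rightarrow> int" where
  "rel_height n I J j = height n j I - height n j J"

definition min_height :: "nat \<Rightarrow> nat set \<Rightarrow> nat set \<Rightarrow> int" where
  "min_height n I J = Min (rel_height n I J ` {1..n})"

text \<open>The sum over offsets \<open>i\<close> in the definition is regrouped by the index \<open>b\<close> that is hit.\<close>

lemma L_form_eq_cdist:
  assumes "n \<ge> 1"
  shows "L_form n j x = (\<Sum>b\<in>{1..n}. of_int (cdist n j b) * x b)"
proof -
  have "L_form n j x = (\<Sum>i\<in>{0..<n}. real i * x (cyc n (j + i)))"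
    unfolding L_form_def using assms by (intro sum.mono_neutral_left) auto
  also have "\<dots> = (\<Sum>b\<in>{1..n}. of_int (cdist n j b) * x b)"
  proof (rule sum.reindex_bij_witness[of _ "\<lambda>b. nat (cdist n j b)" "\<lambda>i. cyc n (j + i)"])
    fix b assume b: "b \<in> {1..n}"
    show "nat (cdist n j b) \<in> {0..<n}" using cdist_bounds[OF assms, of j b] by auto
    show "cyc n (j + nat (cdist n j b)) = b" by (rule cyc_cdist[OF b])
  next
    fix i assume "i \<in> {0..<n}"
    hence i: "cdist n j (cyc n (j + i)) = int i" by (intro cdist_cyc) auto
    show "nat (cdist n j (cyc n (j + i))) = i" by (simp add: i)
    show "cyc n (j + i) \<in> {1..n}" by (rule cyc_in_range[OF assms])
    show "real_of_int (cdist n j (cyc n (j + i))) * x (cyc n (j + i)) = real i * x (cyc n (j + i))"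
      by (simp add: i)
  qed
  finally show ?thesis .
qed

lemma L_form_vertex_diff:
  assumes "n \<ge> 1" "I \<subseteq> {1..n}" "J \<subseteq> {1..n}"
  shows "L_form n j (vertex I - vertex J) = of_int (rel_height n I J j)"
proof -
  have *: "(\<Sum>b\<in>{1..n}. real_of_int (cdist n j b) * vertex A b) = of_int (height n j A)"
    if "A \<subseteq> {1..n}" for A
  proof -
    have "(\<Sum>b\<in>{1..n}. real_of_int (cdist n j b) * vertex A b)
        = (\<Sum>b\<in>A. real_of_int (cdist n j b) * vertex A b)"
      using that by (intro sum.mono_neutral_right) (auto simp: vertex_def)
    thus ?thesis by (simp add: height_def vertex_def)
  qed
  show ?thesis
    using *[OF assms(2)] *[OF assms(3)]
    by (simp add: L_form_eq_cdist[OF assms(1)] rel_height_def right_diff_distrib sum_subtractf)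
qed

lemma rho_vertex_eq_min_height:
  assumes "n \<ge> 1" "I \<subseteq> {1..n}" "J \<subseteq> {1..n}"
  shows "rho n J (vertex I) = of_int (min_height n I J)"
proof -
  have "mono (of_int :: int \<Rightarrow> real)" by (simp add: mono_def)
  hence "of_int (Min (rel_height n I J ` {1..n}))
      = Min (real_of_int ` (rel_height n I J ` {1..n}))"
    using assms(1) by (intro mono_Min_commute) auto
  thus ?thesis
    by (simp add: rho_def h_fun_def L_form_vertex_diff[OF assms] min_height_def image_image)
qed

lemma min_height_eqI:
  assumes "c \<in> {1..n}" "\<And>j. j \<in> {1..n} \<Longrightarrow> rel_height n I J c \<le> rel_height n I J j"
  shows "min_height n I J = rel_height n I J c"
  unfolding min_height_def using assms by (intro Min_eqI) auto

lemma min_height_le: "j \<in> {1..n} \<Longrightarrow> min_height n I J \<le> rel_height n I J j"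
  unfolding min_height_def by (intro Min_le) auto

lemma min_height_attained:
  assumes "n \<ge> 1" shows "\<exists>c\<in>{1..n}. rel_height n I J c = min_height n I J"
proof -
  have "min_height n I J \<in> rel_height n I J ` {1..n}"
    unfolding min_height_def using assms by (intro Min_in) auto
  thus ?thesis by force
qed

text \<open>Moving the base point from \<open>j\<close> to its successor shortens all distances by 1, except that
  the distance to \<open>j\<close> jumps from \<open>0\<close> to \<open>n - 1\<close>. The shortenings cancel as \<open>I\<close> and \<open>J\<close> have the
  same size.\<close>

lemma rel_height_nxt:
  assumes "j \<in> {1..n}" "I \<subseteq> {1..n}" "J \<subseteq> {1..n}" "card I = card J"
  shows "rel_height n I J (nxt n j)
    = rel_height n I J j + (if j \<in> I then int n else 0) - (if j \<in> J then int n else 0)"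
proof -
  have *: "height n (nxt n j) A = height n j A - int (card A) + (if j \<in> A then int n else 0)"
    if "A \<subseteq> {1..n}" for A
  proof -
    have fin: "finite A" using that finite_subset by blast
    have "height n (nxt n j) A = (\<Sum>b\<in>A. cdist n j b - 1 + (if j = b then int n else 0))"
      unfolding height_def using that assms(1) by (intro sum.cong cdist_nxt) auto
    thus ?thesis using fin by (simp add: height_def sum.distrib sum_subtractf)
  qed
  show ?thesis using *[OF assms(2)] *[OF assms(3)] assms(4) by (simp add: rel_height_def)
qed

text \<open>Every step around the circle changes the relative height by \<open>0\<close> or \<open>\<plusminus>n\<close>. As a consequence,
  a value that is not minimal exceeds the minimum by at least \<open>n\<close>.\<close>

lemma rel_height_cong:
  assumes "i \<in> {1..n}" "j \<in> {1..n}" "I \<subseteq> {1..n}" "J \<subseteq> {1..n}" "card I = card J"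
  shows "int n dvd rel_height n I J j - rel_height n I J i"
proof -
  let ?S = "{j \<in> {1..n}. int n dvd rel_height n I J j - rel_height n I J i}"
  have n: "n \<ge> 1" using assms(1) by auto
  have "?S = {1..n}"
  proof (rule nxt_closed_eq_all)
    have "i \<in> ?S" using assms(1) by simp
    thus "?S \<noteq> {}" by blast
    fix a assume a: "a \<in> ?S"
    have "rel_height n I J (nxt n a) - rel_height n I J i
        = (rel_height n I J a - rel_height n I J i)
          + ((if a \<in> I then int n else 0) - (if a \<in> J then int n else 0))"
      using rel_height_nxt[of a n I J] a assms by simp
    moreover have "int n dvd (if a \<in> I then int n else 0) - (if a \<in> J then int n else 0)"
      by simp
    ultimately have "int n dvd rel_height n I J (nxt n a) - rel_height n I J i"
      using a by (simp only: dvd_add mem_Collect_eq)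
    thus "nxt n a \<in> ?S" using nxt_in_range[OF n, of a] by simp
  qed auto
  thus ?thesis using assms(2) by blast
qed

section \<open>Frozen subsets\<close>

text \<open>The cyclic interval of length \<open>k\<close> that begins at \<open>i\<close>. Describing it by distances reduces
  questions about neighbours to \<open>cdist_prv\<close>.\<close>

definition arc :: "nat \<Rightarrow> nat \<Rightarrow> nat \<Rightarrow> nat set" where
  "arc n k i = {x \<in> {1..n}. cdist n i x < int k}"

text \<open>The initial points of the maximal cyclic intervals of which \<open>J\<close> consists.\<close>

definition starts :: "nat \<Rightarrow> nat set \<Rightarrow> nat set" where
  "starts n J = {a \<in> J. prv n a \<notin> J}"

lemma cyc_image_eq_arc:
  assumes "k \<le> n"
  shows "cyc n ` {i..<i + k} = arc n k i"
proof (intro equalityI subsetI)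
  fix x assume "x \<in> cyc n ` {i..<i + k}"
  then obtain m where "m \<in> {i..<i + k}" and x: "x = cyc n m" by blast
  then obtain t where t: "t < k" "x = cyc n (i + t)" by (metis add_less_cancel_left atLeastLessThan_iff le_Suc_ex)
  thus "x \<in> arc n k i"
    using assms cdist_cyc[of t n i] cyc_in_range[of n "i + t"] by (auto simp: arc_def)
next
  fix x assume "x \<in> arc n k i"
  hence x: "x \<in> {1..n}" "cdist n i x < int k" by (auto simp: arc_def)
  hence "nat (cdist n i x) < k" using cdist_bounds[of n i x] by auto
  thus "x \<in> cyc n ` {i..<i + k}"
    using cyc_cdist[OF x(1), of i] by (intro image_eqI[of _ _ "i + nat (cdist n i x)"]) auto
qed

lemma frozen_iff_arc: "k \<le> n \<Longrightarrow> frozen n k J \<longleftrightarrow> (\<exists>i\<in>{1..n}. J = arc n k i)"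
  by (simp add: frozen_def cyc_image_eq_arc)

lemma card_arc:
  assumes "k \<le> n" shows "card (arc n k i) = k"
proof -
  have "inj_on (cyc n) {i..<i + k}"
  proof (rule inj_onI)
    fix x y assume "x \<in> {i..<i + k}" "y \<in> {i..<i + k}" and eq: "cyc n x = cyc n y"
    hence xy: "x = i + (x - i)" "y = i + (y - i)" "x - i < n" "y - i < n"
      using assms by auto
    have "int (x - i) = int (y - i)"
      using cdist_cyc[OF xy(3), of i] cdist_cyc[OF xy(4), of i] eq xy(1,2) by simp
    thus "x = y" using xy(1,2) by linarith
  qed
  thus ?thesis using card_image[of "cyc n" "{i..<i + k}"] cyc_image_eq_arc[OF assms] by simp
qed

lemma starts_arc:
  assumes "1 \<le> k" "k < n" "i \<in> {1..n}"
  shows "starts n (arc n k i) = {i}"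
proof -
  have n: "n \<ge> 1" using assms by auto
  have "a \<in> arc n k i \<and> prv n a \<notin> arc n k i \<longleftrightarrow> a = i" for a
  proof (cases "a \<in> {1..n}")
    case True
    have "cdist n i (prv n a) = cdist n i a - 1 + (if i = a then int n else 0)"
      by (rule cdist_prv[OF assms(3) True])
    moreover have "cdist n i a = 0 \<longleftrightarrow> i = a" by (rule cdist_eq_0_iff[OF assms(3) True])
    ultimately show ?thesis
      using True prv_in_range[OF n, of a] cdist_bounds[OF n, of i a] assms(1,2)
      by (auto simp: arc_def)
  qed (use assms in \<open>auto simp: arc_def\<close>)
  thus ?thesis by (auto simp: starts_def)
qed

lemma finite_ksubsets: "finite (ksubsets n k)"
  by (rule finite_subset[of _ "Pow {1..n}"]) (auto simp: ksubsets_def)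

text \<open>A cyclic interval is determined by its initial point, which it determines in turn by
  \<open>starts_arc\<close>.\<close>

lemma card_frozen_ge:
  assumes "1 \<le> k" "k < n"
  shows "n \<le> card {J \<in> ksubsets n k. frozen n k J}"
proof -
  have "inj_on (arc n k) {1..n}"
    by (rule inj_onI) (metis assms starts_arc singleton_inject)
  hence "n = card (arc n k ` {1..n})" by (simp add: card_image)
  also have "\<dots> \<le> card {J \<in> ksubsets n k. frozen n k J}"
  proof (rule card_mono)
    show "finite {J \<in> ksubsets n k. frozen n k J}" using finite_ksubsets by simp
    show "arc n k ` {1..n} \<subseteq> {J \<in> ksubsets n k. frozen n k J}"
      using assms card_arc[of k n] by (auto simp: frozen_iff_arc ksubsets_def arc_def)
  qed
  finally show ?thesis .
qed

lemma nxt_cyc: "n \<ge> 1 \<Longrightarrow> nxt n (cyc n m) = cyc n (m + 1)"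
  using mod_add_left_eq[of "int (cyc n m)" "int n" 1] mod_add_left_eq[of "int m" "int n" 1]
  by (intro eq_if_int_mod_eq[OF nxt_in_range cyc_in_range])
     (auto simp: int_nxt_mod int_cyc_mod add.commute)

text \<open>On the way around the circle from \<open>i\<close> the relative height never increases while it runs
  through the arc and never decreases afterwards, so it is minimal at the first place after
  the arc. What matters is that this place does not depend on \<open>I\<close>.\<close>

lemma min_height_arc:
  assumes "1 \<le> k" "k < n" "i \<in> {1..n}" "I \<in> ksubsets n k"
  shows "min_height n I (arc n k i) = rel_height n I (arc n k i) (cyc n (i + k))"
proof (rule min_height_eqI)
  have n: "n \<ge> 1" using assms by auto
  show "cyc n (i + k) \<in> {1..n}" by (rule cyc_in_range[OF n])
  \<comment> \<open>the relative height seen on a walk once around the circle\<close>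
  define g where "g t = rel_height n I (arc n k i) (cyc n (i + t))" for t
  have g_Suc: "g (Suc t) = g t + (if cyc n (i + t) \<in> I then int n else 0) - (if t < k then int n else 0)"
    if "t < n" for t
  proof -
    have in_arc: "cyc n (i + t) \<in> arc n k i \<longleftrightarrow> t < k"
      using cdist_cyc[OF that, of i] cyc_in_range[OF n, of "i + t"] by (simp add: arc_def)
    have "rel_height n I (arc n k i) (nxt n (cyc n (i + t)))
      = g t + (if cyc n (i + t) \<in> I then int n else 0) - (if cyc n (i + t) \<in> arc n k i then int n else 0)"
      unfolding g_def using assms card_arc[of k n i]
      by (intro rel_height_nxt cyc_in_range[OF n]) (auto simp: ksubsets_def arc_def)
    thus ?thesis using in_arc by (simp add: nxt_cyc[OF n] g_def)
  qed
  have down: "g k \<le> g t" if "t \<le> k" for t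
    using that
  proof (induction rule: inc_induct)
    case (step m)
    thus ?case using \<open>k < n\<close> g_Suc[of m] by (auto split: if_splits)
  qed simp
  have up: "t \<le> n \<longrightarrow> g k \<le> g t" if "k \<le> t" for t
    using that
  proof (induction rule: dec_induct)
    case (step m)
    thus ?case using g_Suc[of m] by (auto split: if_splits)
  qed simp
  fix j assume j: "j \<in> {1..n}"
  have "g k \<le> g (nat (cdist n i j))"
    using up[of "nat (cdist n i j)"] down[of "nat (cdist n i j)"] cdist_bounds[OF n, of i j]
    by linarith
  thus "rel_height n I (arc n k i) (cyc n (i + k)) \<le> rel_height n I (arc n k i) j"
    by (simp add: g_def cyc_cdist[OF j])
qed

text \<open>The equations of the kinematic space say that \<open>\<Sum>\<^sub>I s\<^sub>I e\<^sub>I = 0\<close>, so every linear function of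
  \<open>e\<^sub>I\<close> sums to zero against \<open>s\<close>. For \<open>k \<ge> 1\<close> so do constant functions, which on
  \<open>k\<close>-subsets are multiples of the sum of the entries of \<open>e\<^sub>I\<close>.\<close>

lemma kinematic_weighted_sum_zero:
  assumes "s \<in> kinematic_space n k"
  shows "(\<Sum>I\<in>ksubsets n k. s I * (\<Sum>b\<in>I. v b)) = 0"
proof -
  have "(\<Sum>I\<in>ksubsets n k. s I * (\<Sum>b\<in>I. v b))
      = (\<Sum>I\<in>ksubsets n k. \<Sum>b\<in>{1..n}. if b \<in> I then s I * v b else 0)"
  proof (rule sum.cong)
    fix I assume "I \<in> ksubsets n k"
    hence "{1..n} \<inter> I = I" by (auto simp: ksubsets_def)
    thus "s I * (\<Sum>b\<in>I. v b) = (\<Sum>b\<in>{1..n}. if b \<in> I then s I * v b else 0)"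
      by (simp add: sum_distrib_left sum.inter_restrict[symmetric])
  qed simp
  also have "\<dots> = (\<Sum>b\<in>{1..n}. \<Sum>I\<in>ksubsets n k. if b \<in> I then s I * v b else 0)"
    by (rule sum.swap)
  also have "\<dots> = (\<Sum>b\<in>{1..n}. (\<Sum>I\<in>{I \<in> ksubsets n k. b \<in> I}. s I) * v b)"
    unfolding sum_distrib_right by (simp add: sum.inter_filter[OF finite_ksubsets])
  also have "\<dots> = 0" using assms by (simp add: kinematic_space_def)
  finally show ?thesis .
qed

lemma kinematic_sum_zero:
  assumes "1 \<le> k" "s \<in> kinematic_space n k"
  shows "(\<Sum>I\<in>ksubsets n k. s I) = 0"
proof -
  have "(\<Sum>I\<in>ksubsets n k. s I) * real k = (\<Sum>I\<in>ksubsets n k. s I * (\<Sum>b\<in>I. 1))"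
    unfolding sum_distrib_right by (rule sum.cong) (auto simp: ksubsets_def)
  also have "\<dots> = 0" by (rule kinematic_weighted_sum_zero[OF assms(2)])
  finally show ?thesis using assms(1) by simp
qed

lemma eta_frozen_eq_0:
  assumes "1 \<le> k" "k < n" "frozen n k J"
  shows "eta n k J = 0"
proof
  fix s
  obtain i where i: "i \<in> {1..n}" and J: "J = arc n k i"
    using assms frozen_iff_arc[of k n J] by auto
  have "(\<Sum>I\<in>ksubsets n k. s I * rho n J (vertex I)) = 0" if s: "s \<in> kinematic_space n k"
  proof -
    let ?c = "cyc n (i + k)"
    have "(\<Sum>I\<in>ksubsets n k. s I * rho n J (vertex I))
        = (\<Sum>I\<in>ksubsets n k. s I * (\<Sum>b\<in>I. of_int (cdist n ?c b)) - s I * of_int (height n ?c J))"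
    proof (rule sum.cong)
      fix I assume I: "I \<in> ksubsets n k"
      have "rho n J (vertex I) = of_int (min_height n I J)"
        using assms I by (intro rho_vertex_eq_min_height) (auto simp: J arc_def ksubsets_def)
      also have "\<dots> = of_int (rel_height n I J ?c)"
        using min_height_arc[OF assms(1,2) i I] by (simp add: J)
      finally show "s I * rho n J (vertex I)
        = s I * (\<Sum>b\<in>I. of_int (cdist n ?c b)) - s I * of_int (height n ?c J)"
        by (simp add: rel_height_def height_def[of _ _ I] right_diff_distrib)
    qed simp
    also have "\<dots> = 0"
      using kinematic_weighted_sum_zero[OF s, of "\<lambda>b. of_int (cdist n ?c b)"]
        kinematic_sum_zero[OF assms(1) s]
      by (simp add: sum_subtractf sum_distrib_right[symmetric])
    finally show ?thesis .
  qed
  thus "eta n k J s = 0 s" by (simp add: eta_def)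
qed

section \<open>Coordinates as alternating sums of planar elements\<close>

text \<open>The elements of \<open>M\<close> move one step back. This is meant for sets \<open>M\<close> of initial points,
  where the new places are free.\<close>

definition shift_back :: "nat \<Rightarrow> nat set \<Rightarrow> nat set \<Rightarrow> nat set" where
  "shift_back n J M = (J - M) \<union> prv n ` M"

lemma
  assumes "J \<in> ksubsets n k" "M \<subseteq> starts n J" "n \<ge> 1"
  shows shift_back_in_ksubsets: "shift_back n J M \<in> ksubsets n k"
    and height_shift_back: "j \<in> {1..n} \<Longrightarrow>
      height n j (shift_back n J M) = height n j J - int (card M) + (if j \<in> M then int n else 0)"
proof -
  have J: "J \<subseteq> {1..n}" "card J = k" and M: "M \<subseteq> J" "prv n ` M \<inter> J = {}"
    using assms(1,2) by (auto simp: ksubsets_def starts_def)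
  have fin: "finite J" "finite M"
    using finite_subset[OF J(1)] finite_subset[OF M(1)] by simp_all
  have inj: "inj_on (prv n) M" using inj_on_subset[OF inj_on_prv order_trans[OF M(1) J(1)]] .
  have disj: "(J - M) \<inter> prv n ` M = {}" using M by blast
  have "card (shift_back n J M) = card (J - M) + card M"
    unfolding shift_back_def using fin disj by (simp add: card_Un_disjoint card_image[OF inj])
  also have "\<dots> = k"
    using fin M J card_mono[OF fin(1) M(1)] by (simp add: card_Diff_subset)
  finally show "shift_back n J M \<in> ksubsets n k"
    using J prv_in_range[OF assms(3)] by (auto simp: ksubsets_def shift_back_def)
  assume j: "j \<in> {1..n}"
  have "height n j (shift_back n J M) = height n j (J - M) + (\<Sum>a\<in>M. cdist n j (prv n a))"
    unfolding shift_back_def height_def using fin disj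
    by (simp add: sum.union_disjoint sum.reindex[OF inj])
  also have "(\<Sum>a\<in>M. cdist n j (prv n a)) = (\<Sum>a\<in>M. cdist n j a - 1 + (if j = a then int n else 0))"
    using j J M by (intro sum.cong cdist_prv) auto
  also have "\<dots> = height n j M - int (card M) + (if j \<in> M then int n else 0)"
    using fin by (simp add: height_def sum.distrib sum_subtractf)
  also have "height n j (J - M) = height n j J - height n j M"
    unfolding height_def using fin M by (simp add: sum_diff)
  finally show "height n j (shift_back n J M)
      = height n j J - int (card M) + (if j \<in> M then int n else 0)" by simp
qed

definition minimizers :: "nat \<Rightarrow> nat set \<Rightarrow> nat set \<Rightarrow> nat set" where
  "minimizers n I J = {j \<in> {1..n}. rel_height n I J j = min_height n I J}"

text \<open>The shift adds \<open>|M|\<close> to all relative heights and subtracts \<open>n\<close> at the points of \<open>M\<close>. The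
  subtraction lowers the minimum by \<open>n\<close> if it hits a minimizer. If it hits only other
  points, the minimum stays, since their values exceed it by at least \<open>n\<close>.\<close>

lemma min_height_shift_back:
  assumes "n \<ge> 1" "I \<in> ksubsets n k" "J \<in> ksubsets n k" "M \<subseteq> starts n J"
  shows "min_height n I (shift_back n J M)
    = min_height n I J + int (card M) - (if M \<inter> minimizers n I J = {} then 0 else int n)"
proof -
  have IJ: "I \<subseteq> {1..n}" "J \<subseteq> {1..n}" "card I = card J"
    using assms by (auto simp: ksubsets_def)
  have rel: "rel_height n I (shift_back n J M) j
      = rel_height n I J j + int (card M) - (if j \<in> M then int n else 0)" if "j \<in> {1..n}" for j
    using height_shift_back[OF assms(3,4,1) that] by (simp add: rel_height_def)
  note le = min_height_le[of _ n I J]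
  show ?thesis
  proof (cases "M \<inter> minimizers n I J = {}")
    case False
    then obtain c where c: "c \<in> M" "c \<in> {1..n}" "rel_height n I J c = min_height n I J"
      by (auto simp: minimizers_def)
    have "min_height n I (shift_back n J M) = rel_height n I (shift_back n J M) c"
    proof (rule min_height_eqI[OF c(2)])
      fix j assume j: "j \<in> {1..n}"
      show "rel_height n I (shift_back n J M) c \<le> rel_height n I (shift_back n J M) j"
        unfolding rel[OF j] rel[OF c(2)] using le[OF j] c by simp
    qed
    thus ?thesis using rel[OF c(2)] c False by simp
  next
    case True
    obtain c where c: "c \<in> {1..n}" "rel_height n I J c = min_height n I J"
      using min_height_attained[OF assms(1)] by blast
    hence cM: "c \<notin> M" using True by (auto simp: minimizers_def)
    have "min_height n I (shift_back n J M) = rel_height n I (shift_back n J M) c"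
    proof (rule min_height_eqI[OF c(1)])
      fix j assume j: "j \<in> {1..n}"
      have "rel_height n I J c \<le> rel_height n I J j - int n" if "j \<in> M"
      proof -
        have "rel_height n I J j \<noteq> min_height n I J" using True that j by (auto simp: minimizers_def)
        hence "rel_height n I J j - rel_height n I J c > 0" using le[OF j] c by simp
        moreover have "int n dvd rel_height n I J j - rel_height n I J c"
          by (rule rel_height_cong[OF c(1) j IJ])
        ultimately have "int n \<le> rel_height n I J j - rel_height n I J c" by (rule zdvd_imp_le[rotated])
        thus ?thesis by simp
      qed
      thus "rel_height n I (shift_back n J M) c \<le> rel_height n I (shift_back n J M) j"
        unfolding rel[OF j] rel[OF c(1)] using le[OF j] c cM by simp
    qed
    thus ?thesis using rel[OF c(1)] c cM True by simp
  qed
qed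

text \<open>Suppose that all initial points are minimizers and consider the set of non-minimizers.
  The relative height does not increase along \<open>J\<close>, so a non-minimizer in \<open>J\<close>, not being an
  initial point, has its predecessor in \<open>J\<close> and this is a non-minimizer as well; the
  non-minimizers in \<open>J\<close> would fill the circle, contrary to \<open>k < n\<close>. Off \<open>J\<close> the relative
  height does not decrease, so there non-minimizers propagate forward and would fill the
  circle too, contrary to \<open>k \<ge> 1\<close>. Hence the relative height is constant, and its increments
  show \<open>I = J\<close>.\<close>

lemma starts_subset_minimizers_iff:
  assumes "1 \<le> k" "k < n" "I \<in> ksubsets n k" "J \<in> ksubsets n k"
  shows "starts n J \<subseteq> minimizers n I J \<longleftrightarrow> I = J"
proof
  assume "I = J"
  hence rel: "rel_height n I J = (\<lambda>j. 0)" by (simp add: rel_height_def fun_eq_iff)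
  hence "min_height n I J = 0" using min_height_attained[of n I J] assms(1,2) by simp
  with rel show "starts n J \<subseteq> minimizers n I J"
    using assms(4) by (auto simp: minimizers_def starts_def ksubsets_def)
next
  assume sub: "starts n J \<subseteq> minimizers n I J"
  have n: "n \<ge> 1" using assms by simp
  have IJ: "I \<subseteq> {1..n}" "J \<subseteq> {1..n}" "card I = card J" and J: "card J = k"
    using assms by (auto simp: ksubsets_def)
  have J_proper: "J \<noteq> {}" "J \<noteq> {1..n}" using J assms(1,2) by auto
  let ?T = "{1..n} - minimizers n I J"
  have in_minI: "j \<in> minimizers n I J"
    if "i \<in> minimizers n I J" "j \<in> {1..n}" "rel_height n I J j \<le> rel_height n I J i" for i j
    using that min_height_le[of j n I J] by (auto simp: minimizers_def)
  have prv_closed: "prv n j \<in> ?T \<inter> J" if "j \<in> ?T \<inter> J" for j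
  proof -
    from that sub have p: "prv n j \<in> J" by (auto simp: starts_def)
    have "rel_height n I J j \<le> rel_height n I J (prv n j)"
      using rel_height_nxt[of "prv n j" n I J] nxt_prv[of j n] prv_in_range[OF n, of j] IJ p that
      by (auto split: if_splits)
    hence "prv n j \<notin> minimizers n I J" using in_minI[of "prv n j" j] that by auto
    thus ?thesis using p prv_in_range[OF n, of j] by auto
  qed
  have TJ: "?T \<inter> J = {}"
  proof (rule ccontr)
    assume "?T \<inter> J \<noteq> {}"
    hence "?T \<inter> J = {1..n}" using prv_closed by (intro prv_closed_eq_all) auto
    thus False using J_proper IJ by auto
  qed
  have "?T = {}"
  proof (rule ccontr)
    assume "?T \<noteq> {}"
    moreover have "nxt n j \<in> ?T" if "j \<in> ?T" for j
    proof -
      have "j \<notin> J" using TJ that by auto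
      hence "rel_height n I J j \<le> rel_height n I J (nxt n j)"
        using rel_height_nxt[of j n I J] IJ that by auto
      thus ?thesis using in_minI[of "nxt n j" j] that nxt_in_range[OF n, of j] by auto
    qed
    ultimately have "?T = {1..n}" by (intro nxt_closed_eq_all) auto
    thus False using TJ J_proper IJ by auto
  qed
  hence const: "rel_height n I J j = min_height n I J" if "j \<in> {1..n}" for j
    using that by (auto simp: minimizers_def)
  have "j \<in> I \<longleftrightarrow> j \<in> J" if "j \<in> {1..n}" for j
    using rel_height_nxt[OF that IJ] const[OF that] const[OF nxt_in_range[OF n, of j]] n
    by (auto split: if_splits)
  thus "I = J" using IJ by blast
qed

lemma sum_Pow_minus_one_power_card:
  assumes "finite A"
  shows "(\<Sum>M\<in>Pow A. (-1) ^ card M) = (if A = {} then 1 else (0::real))"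
proof -
  have "(\<Prod>x\<in>A. (-1) + 1) = (\<Sum>M\<in>Pow A. (\<Prod>x\<in>M. -1) * (\<Prod>x\<in>A - M. 1::real))"
    by (rule prod_add[OF assms])
  thus ?thesis using assms by (simp add: power_0_left)
qed

text \<open>By \<open>min_height_shift_back\<close> the term for \<open>M\<close> contains the constant \<open>min_height n I J - n\<close>,
  which cancels because \<open>starts n J\<close> is nonempty, the summand \<open>|M|\<close>, which contributes the
  same to every \<open>I\<close>, and \<open>n\<close> for those \<open>M\<close> that avoid the minimizers. The last kind sums to
  zero unless no initial point avoids the minimizers.\<close>

lemma alternating_sum_min_height:
  assumes "1 \<le> k" "k < n" "I \<in> ksubsets n k" "J \<in> ksubsets n k"
  shows "(\<Sum>M\<in>Pow (starts n J). (-1) ^ card M * real_of_int (min_height n I (shift_back n J M)))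
    = (\<Sum>M\<in>Pow (starts n J). (-1) ^ card M * real (card M)) + (if I = J then real n else 0)"
proof -
  let ?B = "starts n J" and ?A = "minimizers n I J"
  have fin: "finite ?B" using assms(4) finite_subset[of J "{1..n}"] by (auto simp: starts_def ksubsets_def)
  have n: "n \<ge> 1" using assms by simp
  have B: "?B \<noteq> {}"
  proof
    assume "?B = {}"
    hence "J = {1..n}"
      using assms(1,4) by (intro prv_closed_eq_all) (auto simp: starts_def ksubsets_def)
    thus False using assms(2,4) by (simp add: ksubsets_def)
  qed
  have split: "(-1) ^ card M * real_of_int (min_height n I (shift_back n J M))
      = (real_of_int (min_height n I J) - n) * (-1) ^ card M + (-1) ^ card M * real (card M)
        + real n * (if M \<inter> ?A = {} then (-1) ^ card M else 0)" if "M \<in> Pow ?B" for M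
  proof -
    have "real_of_int (min_height n I (shift_back n J M))
        = real_of_int (min_height n I J) + real (card M) - (if M \<inter> ?A = {} then 0 else real n)"
      using min_height_shift_back[OF n assms(3,4), of M] that by simp
    thus ?thesis by (simp only:) (simp add: algebra_simps)
  qed
  have "(\<Sum>M\<in>Pow ?B. if M \<inter> ?A = {} then (-1) ^ card M else 0) = (\<Sum>M\<in>Pow (?B - ?A). (-1) ^ card M :: real)"
    using fin by (intro sum.mono_neutral_cong_right) auto
  also have "\<dots> = (if I = J then 1 else 0)"
    using sum_Pow_minus_one_power_card[of "?B - ?A"] fin starts_subset_minimizers_iff[OF assms] by auto
  finally have last: "(\<Sum>M\<in>Pow ?B. if M \<inter> ?A = {} then (-1) ^ card M else 0) = (if I = J then 1 else 0 :: real)" .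
  have "(\<Sum>M\<in>Pow ?B. (-1) ^ card M * real_of_int (min_height n I (shift_back n J M)))
      = (\<Sum>M\<in>Pow ?B. (real_of_int (min_height n I J) - n) * (-1) ^ card M + (-1) ^ card M * real (card M)
        + real n * (if M \<inter> ?A = {} then (-1) ^ card M else 0))"
    by (rule sum.cong[OF refl split])
  also have "\<dots> = (real_of_int (min_height n I J) - n) * (\<Sum>M\<in>Pow ?B. (-1) ^ card M)
      + (\<Sum>M\<in>Pow ?B. (-1) ^ card M * real (card M)) + real n * (if I = J then 1 else 0)"
    unfolding last[symmetric] by (simp add: sum.distrib sum_distrib_left)
  finally show ?thesis using sum_Pow_minus_one_power_card[OF fin] B by simp
qed

text \<open>Extended by zero off the kinematic space, as the elements of its \<open>dual_space\<close> are.\<close>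

definition coordinate :: "nat \<Rightarrow> nat \<Rightarrow> nat set \<Rightarrow> (nat set \<Rightarrow> real) \<Rightarrow> real" where
  "coordinate n k J = (\<lambda>s. if s \<in> kinematic_space n k then s J else 0)"

text \<open>The part of the previous identity that does not depend on \<open>I\<close> disappears because the
  coordinates of \<open>s\<close> sum to zero.\<close>

lemma alternating_sum_eta:
  assumes "1 \<le> k" "k < n" "J \<in> ksubsets n k" "s \<in> kinematic_space n k"
  shows "(\<Sum>M\<in>Pow (starts n J). (-1) ^ card M * eta n k (shift_back n J M) s) = - s J"
proof -
  let ?B = "starts n J" and ?K = "ksubsets n k"
  let ?C = "\<Sum>M\<in>Pow (starts n J). (-1) ^ card M * real (card M)"
  have n: "n \<ge> 1" using assms by simp
  have rho: "rho n (shift_back n J M) (vertex I) = of_int (min_height n I (shift_back n J M))"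
    if "M \<in> Pow ?B" "I \<in> ?K" for M I
    using shift_back_in_ksubsets[OF assms(3) _ n, of M] that
    by (intro rho_vertex_eq_min_height[OF n]) (auto simp: ksubsets_def)
  have "(\<Sum>M\<in>Pow ?B. (-1) ^ card M * eta n k (shift_back n J M) s)
      = (\<Sum>M\<in>Pow ?B. \<Sum>I\<in>?K. - (1 / real n) * s I
          * ((-1) ^ card M * of_int (min_height n I (shift_back n J M))))"
  proof (rule sum.cong)
    fix M assume M: "M \<in> Pow ?B"
    have "eta n k (shift_back n J M) s
        = - (1 / real n) * (\<Sum>I\<in>?K. s I * of_int (min_height n I (shift_back n J M)))"
      using assms(4) rho[OF M] by (simp add: eta_def)
    thus "(-1) ^ card M * eta n k (shift_back n J M) s
        = (\<Sum>I\<in>?K. - (1 / real n) * s I * ((-1) ^ card M * of_int (min_height n I (shift_back n J M))))"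
      by (simp only: sum_distrib_left mult_ac)
  qed simp
  also have "\<dots> = (\<Sum>I\<in>?K. - (1 / real n) * s I
      * (\<Sum>M\<in>Pow ?B. (-1) ^ card M * of_int (min_height n I (shift_back n J M))))"
    unfolding sum_distrib_left by (rule sum.swap)
  also have "\<dots> = (\<Sum>I\<in>?K. - (?C / real n) * s I - (if I = J then s J else 0))"
    using alternating_sum_min_height[OF assms(1,2) _ assms(3)] n
    by (intro sum.cong) (auto simp: field_simps)
  also have "\<dots> = - (?C / real n) * (\<Sum>I\<in>?K. s I) - s J"
    unfolding sum_subtractf sum_distrib_left[symmetric] using assms(3) finite_ksubsets[of n k] by simp
  finally show ?thesis using kinematic_sum_zero[OF assms(1,4)] by simp
qed

lemma sum_apply: "(\<Sum>x\<in>A. f x) y = (\<Sum>x\<in>A. f x y)"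
  by (induction A rule: infinite_finite_induct) auto

lemma coordinate_in_span_eta:
  assumes "1 \<le> k" "k < n" "J \<in> ksubsets n k"
  shows "coordinate n k J \<in> span (eta n k ` {J \<in> ksubsets n k. \<not> frozen n k J})"
proof -
  let ?E = "eta n k ` {J \<in> ksubsets n k. \<not> frozen n k J}"
  have eta: "eta n k L \<in> span ?E" if "L \<in> ksubsets n k" for L
  proof (cases "frozen n k L")
    case True
    thus ?thesis using eta_frozen_eq_0[OF assms(1,2)] by (simp add: span_zero)
  qed (use that in \<open>auto intro: span_base\<close>)
  have "coordinate n k J = - (\<Sum>M\<in>Pow (starts n J). (-1) ^ card M *\<^sub>R eta n k (shift_back n J M))"
    (is "_ = - ?S")
  proof
    fix s show "coordinate n k J s = (- ?S) s"
      using alternating_sum_eta[OF assms, of s]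
      by (cases "s \<in> kinematic_space n k")
         (auto simp: coordinate_def sum_apply scaleR_fun_def eta_def)
  qed
  moreover have "?S \<in> span ?E"
    using assms by (intro span_sum span_scale eta shift_back_in_ksubsets) auto
  ultimately show ?thesis by (simp add: span_neg)
qed

section \<open>The dual of the kinematic space and its dimension\<close>

text \<open>A linear function on the kinematic space extends to all of the surrounding space of
  functions, where it can be expanded in terms of its values at the unit vectors \<open>d J\<close>. The
  extension is needed because these are in general not points of the kinematic space.\<close>

lemma dual_space_kinematic_subset_span_coordinate:
  "dual_space (kinematic_space n k) \<subseteq> span (coordinate n k ` ksubsets n k)"
proof
  fix f assume f: "f \<in> dual_space (kinematic_space n k)"
  let ?V = "kinematic_space n k"
  note sub = subspace_kinematic_space[of n k]
  define d where "d J = (\<lambda>I. if I = J then 1 else (0::real))" for J :: "nat set"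
  obtain B where B: "B \<subseteq> ?V" "independent B" "?V \<subseteq> span B"
    using maximal_independent_subset[of ?V] by blast
  obtain g where g: "linear g" "\<forall>x\<in>B. g x = f x"
    using linear_independent_extend[OF B(2), of f] by blast
  have fg: "f s = g s \<and> s \<in> ?V" if "s \<in> ?V" for s
  proof -
    have "s \<in> span B" using that B by blast
    thus ?thesis
    proof (induction rule: span_induct_alt)
      case base
      have "f 0 = 0" using f subspace_0[OF sub] unfolding dual_space_def
        by (metis (mono_tags, lifting) mem_Collect_eq mult_zero_left scaleR_zero_left)
      thus ?case using subspace_0[OF sub] linear_0[OF g(1)] by (simp add: zero_fun_def)
    next
      case (step c x y)
      hence x: "x \<in> ?V" "g x = f x" using B g by auto
      hence cx: "c *\<^sub>R x \<in> ?V" by (simp add: subspace_scale[OF sub])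
      have "f (c *\<^sub>R x + y) = c * f x + f y"
        using f x cx step unfolding dual_space_def by simp
      moreover have "g (c *\<^sub>R x + y) = c * g x + g y"
        using g(1) by (simp add: linear_add linear_scale)
      ultimately show ?case using x step subspace_add[OF sub cx] by (simp add: plus_fun_def)
    qed
  qed
  have "f = (\<Sum>J\<in>ksubsets n k. g (d J) *\<^sub>R coordinate n k J)"
  proof
    fix s
    show "f s = (\<Sum>J\<in>ksubsets n k. g (d J) *\<^sub>R coordinate n k J) s"
    proof (cases "s \<in> ?V")
      case True
      have "s = (\<Sum>J\<in>ksubsets n k. s J *\<^sub>R d J)"
      proof
        fix I
        have "(\<Sum>J\<in>ksubsets n k. s J *\<^sub>R d J) I = (\<Sum>J\<in>ksubsets n k. if I = J then s J else 0)"
          by (auto simp: sum_apply scaleR_fun_def d_def intro!: sum.cong)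
        also have "\<dots> = s I" using True finite_ksubsets[of n k] by (simp add: kinematic_space_def)
        finally show "s I = (\<Sum>J\<in>ksubsets n k. s J *\<^sub>R d J) I" by simp
      qed
      hence "g s = g (\<Sum>J\<in>ksubsets n k. s J *\<^sub>R d J)" by simp
      also have "\<dots> = (\<Sum>J\<in>ksubsets n k. s J * g (d J))"
        using g(1) by (simp add: linear_sum linear_scale)
      finally show ?thesis using fg[OF True] True
        by (simp add: sum_apply scaleR_fun_def coordinate_def mult.commute)
    next
      case False
      thus ?thesis using f by (simp add: dual_space_def sum_apply scaleR_fun_def coordinate_def)
    qed
  qed
  moreover have "\<dots> \<in> span (coordinate n k ` ksubsets n k)"
    by (intro span_sum span_scale span_base imageI)
  ultimately show "f \<in> span (coordinate n k ` ksubsets n k)" by simp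
qed

text \<open>The columns \<open>v x\<close> of the system lie in the span of \<open>card E\<close> unit vectors. Being more than
  \<open>card E\<close> in number, they are either not distinct or linearly dependent, and both give a
  nonzero solution.\<close>

lemma homogeneous_system_solution:
  fixes c :: "'e \<Rightarrow> 'b \<Rightarrow> real"
  assumes "finite X" "finite E" "card E < card X"
  shows "\<exists>s. (\<forall>x. x \<notin> X \<longrightarrow> s x = 0) \<and> (\<exists>x\<in>X. s x \<noteq> 0) \<and> (\<forall>e\<in>E. (\<Sum>x\<in>X. s x * c e x) = 0)"
proof -
  define v where "v x = (\<lambda>e. if e \<in> E then c e x else 0)" for x
  define u where "u e = (\<lambda>e'. if e' = e then 1 else (0::real))" for e :: 'e
  show ?thesis
  proof (cases "inj_on v X")
    case True
    have "v x \<in> span (u ` E)" for x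
    proof -
      have "v x = (\<Sum>e\<in>E. c e x *\<^sub>R u e)"
      proof
        fix e'
        have "(\<Sum>e\<in>E. c e x *\<^sub>R u e) e' = (\<Sum>e\<in>E. if e' = e then c e x else 0)"
          by (auto simp: sum_apply scaleR_fun_def u_def intro!: sum.cong)
        thus "v x e' = (\<Sum>e\<in>E. c e x *\<^sub>R u e) e'" using assms(2) by (simp add: v_def)
      qed
      moreover have "\<dots> \<in> span (u ` E)" by (intro span_sum span_scale span_base imageI)
      ultimately show ?thesis by simp
    qed
    hence "v ` X \<subseteq> span (u ` E)" by blast
    moreover have "\<not> card (v ` X) \<le> card (u ` E)"
      using card_image[OF True] card_image_le[OF assms(2), of u] assms(3) by simp
    ultimately have "dependent (v ` X)"
      using independent_span_bound[of "u ` E" "v ` X"] assms(2) by blast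
    then obtain w where w: "\<exists>y\<in>v ` X. w y \<noteq> 0" "(\<Sum>y\<in>v ` X. w y *\<^sub>R y) = 0"
      using dependent_finite[of "v ` X"] assms(1) by auto
    define s where "s x = (if x \<in> X then w (v x) else 0)" for x
    have "(\<Sum>x\<in>X. s x * c e x) = 0" if "e \<in> E" for e
    proof -
      have "(\<Sum>x\<in>X. s x * c e x) = (\<Sum>x\<in>X. w (v x) *\<^sub>R v x) e"
        using that by (simp add: sum_apply scaleR_fun_def s_def v_def)
      also have "(\<Sum>x\<in>X. w (v x) *\<^sub>R v x) = 0"
        using w(2) by (simp add: sum.reindex[OF True])
      finally show ?thesis by simp
    qed
    thus ?thesis using w(1) by (intro exI[of _ s]) (auto simp: s_def)
  next
    case False
    then obtain a b where ab: "a \<in> X" "b \<in> X" "a \<noteq> b" "v a = v b" by (auto simp: inj_on_def)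
    define s where "s x = (if x = a then 1 else if x = b then -1 else (0::real))" for x
    have "(\<Sum>x\<in>X. s x * c e x) = 0" if "e \<in> E" for e
    proof -
      have "(\<Sum>x\<in>X. s x * c e x) = (\<Sum>x\<in>{a, b}. s x * c e x)"
        using ab assms(1) by (intro sum.mono_neutral_right) (auto simp: s_def)
      also have "\<dots> = v a e - v b e" using ab(3) that by (simp add: s_def v_def)
      finally show ?thesis using ab(4) by simp
    qed
    thus ?thesis using ab by (intro exI[of _ s]) (auto simp: s_def)
  qed
qed

text \<open>The system consists of the \<open>n\<close> equations of the kinematic space (\<open>Inl\<close>) and the vanishing of
  the planar elements from \<open>F\<close> (\<open>Inr\<close>). A nonzero solution \<open>s\<close> is a point of the kinematic
  space at which everything in the span of these planar elements vanishes, but some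
  coordinate function does not.\<close>

lemma few_eta_not_spanning:
  assumes "finite F" "card F + n < card (ksubsets n k)"
  shows "\<not> dual_space (kinematic_space n k) \<subseteq> span (eta n k ` F)"
proof
  let ?K = "ksubsets n k" and ?V = "kinematic_space n k"
  assume sub: "dual_space ?V \<subseteq> span (eta n k ` F)"
  define c where "c e I = (case e of Inl a \<Rightarrow> if a \<in> I then 1 else 0 | Inr J \<Rightarrow> rho n J (vertex I))"
    for e :: "nat + nat set" and I
  have card: "card ({1..n} <+> F) < card ?K"
    using assms by (simp add: card_Plus)
  obtain s where s: "\<And>I. I \<notin> ?K \<Longrightarrow> s I = 0" "\<exists>I\<in>?K. s I \<noteq> 0"
    "\<And>e. e \<in> {1..n} <+> F \<Longrightarrow> (\<Sum>I\<in>?K. s I * c e I) = 0"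
    using homogeneous_system_solution[OF finite_ksubsets _ card, of c] assms(1) by auto
  have "s \<in> ?V"
    using s(1) s(3)[of "Inl _"] finite_ksubsets[of n k]
    by (auto simp: kinematic_space_def c_def sum.inter_filter if_distrib cong: if_cong)
  have eta_s: "eta n k J s = 0" if "J \<in> F" for J
    using s(3)[of "Inr J"] that by (auto simp: eta_def c_def)
  have van: "f s = 0" if "f \<in> span (eta n k ` F)" for f
    using that by (induction rule: span_induct_alt) (auto simp: scaleR_fun_def eta_s)
  obtain I where I: "I \<in> ?K" "s I \<noteq> 0" using s(2) by blast
  have "coordinate n k I \<in> dual_space ?V"
    using subspace_add[OF subspace_kinematic_space] subspace_scale[OF subspace_kinematic_space]
    by (auto simp: dual_space_def coordinate_def scaleR_fun_def)
  hence "coordinate n k I s = 0" using sub van by blast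
  thus False using I \<open>s \<in> ?V\<close> by (simp add: coordinate_def)
qed

theorem theorem3p11:
  fixes n k :: nat
  assumes "1 \<le> k" and "k \<le> n - 1"
  shows "independent {eta n k J | J. J \<in> ksubsets n k \<and> \<not> frozen n k J} \<and>
         span {eta n k J | J. J \<in> ksubsets n k \<and> \<not> frozen n k J} = dual_space (kinematic_space n k)"
proof -
  let ?N = "{J \<in> ksubsets n k. \<not> frozen n k J}" and ?D = "dual_space (kinematic_space n k)"
  have k: "k < n" using assms by simp
  have E: "{eta n k J | J. J \<in> ksubsets n k \<and> \<not> frozen n k J} = eta n k ` ?N" by auto
  have "?D \<subseteq> span (coordinate n k ` ksubsets n k)"
    by (rule dual_space_kinematic_subset_span_coordinate)
  also have "\<dots> \<subseteq> span (eta n k ` ?N)"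
    using coordinate_in_span_eta[OF assms(1) k] by (intro span_minimal) auto
  finally have spans: "?D \<subseteq> span (eta n k ` ?N)" .
  have sub: "span (eta n k ` ?N) \<subseteq> ?D"
    using subspace_dual_space[OF subspace_kinematic_space] eta_in_dual_space
    by (intro span_minimal) auto
  have "independent (eta n k ` ?N)"
  proof
    assume "dependent (eta n k ` ?N)"
    then obtain J where J: "J \<in> ?N" and dep: "eta n k J \<in> span (eta n k ` ?N - {eta n k J})"
      unfolding dependent_def by blast
    \<comment> \<open>The bound below counts sets \<open>J\<close>, so removing a function is replaced by removing one of
      the sets that define it.\<close>
    have "span (eta n k ` ?N - {eta n k J}) \<subseteq> span (eta n k ` (?N - {J}))"
      by (intro span_mono) auto
    hence "eta n k J \<in> span (eta n k ` (?N - {J}))" using dep by blast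
    hence "span (insert (eta n k J) (eta n k ` (?N - {J}))) = span (eta n k ` (?N - {J}))"
      by (rule span_redundant)
    moreover have "insert (eta n k J) (eta n k ` (?N - {J})) = eta n k ` ?N" using J by auto
    ultimately have "?D \<subseteq> span (eta n k ` (?N - {J}))" using spans by simp
    moreover have "card (?N - {J}) + n < card (ksubsets n k)"
    proof -
      have fin: "finite ?N" using finite_ksubsets by simp
      have "card ?N + card {J \<in> ksubsets n k. frozen n k J} = card (ksubsets n k)"
        using finite_ksubsets[of n k] by (subst card_Un_disjoint[symmetric]) (auto intro: arg_cong[where f=card])
      moreover have "card (?N - {J}) < card ?N" using fin J by (intro psubset_card_mono) auto
      ultimately show ?thesis using card_frozen_ge[OF assms(1) k] by linarith
    qed
    ultimately show False
      using few_eta_not_spanning[of "?N - {J}" n k] finite_ksubsets[of n k] by auto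
  qed
  thus ?thesis unfolding E using spans sub by blast
qed

end
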